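(* Let $N\ge 1$ and $N<p<\infty$ with $p>1$. There exists a constant $C>0$ depending only on $p$ and $N$ such that the following holds. Let $\Omega\subset\mathbb{R}^N$ be an open set, let $w\in L^1(\Omega)$ be a non-negative weight, and let $u\in W^{1,p}_0(\Omega)$ be a nontrivial (weak) solution of $$-\Delta_p u = w(x)|u|^{p-2}u \ \text{ in } \Omega,\qquad u=0\ \text{ on }\partial\Omega .$$ Then $$\frac{C}{r_\Omega^{\,p-N}}\le \|w\|_{L^1(\Omega)} .$$
   Context: $\Delta_p u=\operatorname{div}(|\nabla u|^{p-2}\nabla u)$ is the $p$-Laplacian. The inner radius of $\Omega$ is $r_\Omega=\sup_{x\in\Omega} d_\Omega(x)$, where $d_\Omega(x)=\inf_{y\in\partial\Omega}|x-y|$ is the distance from $x$ to the boundary (if $r_\Omega=\infty$, the left-hand side of the inequality is read as $0$). A function $u\in W^{1,p}_0(\Omega)$ is a (weak) solution if $\int_\Omega |\nabla u|^{p-2}\nabla u\cdot\nabla\varphi\,dx=\int_\Omega w|u|^{p-2}u\,\varphi\,dx$ for every $\varphi\in W^{1,p}_0(\Omega)$; nontrivial means $u\not\equiv 0$. *)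

theory Defs
  imports "HOL-Analysis.Analysis"
begin

definition partial_deriv :: "'n::finite \<Rightarrow> (real^'n \<Rightarrow> real) \<Rightarrow> real^'n \<Rightarrow> real" where
  "partial_deriv i f x = frechet_derivative f (at x) (axis i 1)"

definition grad :: "(real^'n::finite \<Rightarrow> real) \<Rightarrow> real^'n \<Rightarrow> real^'n" where
  "grad f x = (\<chi> i. partial_deriv i f x)"

text \<open>The class \<open>C\<^sup>k\<close> on the whole space, by iterated partial derivatives.\<close>

primrec C_k :: "nat \<Rightarrow> (real^'n::finite \<Rightarrow> real) \<Rightarrow> bool" where
  "C_k 0 f \<longleftrightarrow> continuous_on UNIV f"
| "C_k (Suc k) f \<longleftrightarrow> f differentiable_on UNIV \<and> (\<forall>i. C_k k (partial_deriv i f))"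

text \<open>\<open>C\<^sub>c\<^sup>\<infinity>(\<Omega>)\<close>, each function being extended by zero to the whole space.\<close>

definition test_functions :: "(real^'n::finite) set \<Rightarrow> (real^'n \<Rightarrow> real) set" where
  "test_functions \<Omega> =
     {\<phi>. (\<forall>k. C_k k \<phi>) \<and> compact (closure {x. \<phi> x \<noteq> 0}) \<and> closure {x. \<phi> x \<noteq> 0} \<subseteq> \<Omega>}"

text \<open>Functions on \<open>\<Omega>\<close> are represented by total functions whose values outside \<open>\<Omega>\<close> are
  irrelevant; elements of Lebesgue and Sobolev spaces are represented by functions rather than
  by classes modulo almost-everywhere equality.\<close>

definition L_p :: "real \<Rightarrow> (real^'n::finite) set \<Rightarrow> (real^'n \<Rightarrow> 'b::euclidean_space) set" where
  "L_p p \<Omega> = {f \<in> borel_measurable (lebesgue_on \<Omega>).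
                 integrable (lebesgue_on \<Omega>) (\<lambda>x. norm (f x) powr p)}"

definition L_p_norm :: "real \<Rightarrow> (real^'n::finite) set \<Rightarrow> (real^'n \<Rightarrow> 'b::euclidean_space) \<Rightarrow> real" where
  "L_p_norm p \<Omega> f = (LINT x|lebesgue_on \<Omega>. norm (f x) powr p) powr (1 / p)"

definition locally_integrable_on ::
    "(real^'n::finite \<Rightarrow> 'b::euclidean_space) \<Rightarrow> (real^'n) set \<Rightarrow> bool" where
  "locally_integrable_on f \<Omega> \<longleftrightarrow> (\<forall>K. compact K \<and> K \<subseteq> \<Omega> \<longrightarrow> integrable (lebesgue_on K) f)"

definition is_weak_grad ::
    "(real^'n::finite) set \<Rightarrow> (real^'n \<Rightarrow> real) \<Rightarrow> (real^'n \<Rightarrow> real^'n) \<Rightarrow> bool" where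
  "is_weak_grad \<Omega> u g \<longleftrightarrow>
     locally_integrable_on u \<Omega> \<and> locally_integrable_on g \<Omega> \<and>
     (\<forall>\<phi>\<in>test_functions \<Omega>. \<forall>i.
        (LINT x|lebesgue_on \<Omega>. u x * partial_deriv i \<phi> x)
          = - (LINT x|lebesgue_on \<Omega>. g x $ i * \<phi> x))"

text \<open>The weak gradient is unique up to null sets, so the choice of representative is immaterial.\<close>

definition weak_grad :: "(real^'n::finite) set \<Rightarrow> (real^'n \<Rightarrow> real) \<Rightarrow> real^'n \<Rightarrow> real^'n" where
  "weak_grad \<Omega> u = (SOME g. is_weak_grad \<Omega> u g)"

definition W1p :: "real \<Rightarrow> (real^'n::finite) set \<Rightarrow> (real^'n \<Rightarrow> real) set" where
  "W1p p \<Omega> = {u \<in> L_p p \<Omega>. (\<exists>g. is_weak_grad \<Omega> u g) \<and> weak_grad \<Omega> u \<in> L_p p \<Omega>}"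

text \<open>\<open>W\<^sub>0\<^sup>1\<^sup>,\<^sup>p(\<Omega>)\<close>: the closure of \<open>C\<^sub>c\<^sup>\<infinity>(\<Omega>)\<close> in \<open>W\<^sup>1\<^sup>,\<^sup>p(\<Omega>)\<close>.\<close>

definition W1p_0 :: "real \<Rightarrow> (real^'n::finite) set \<Rightarrow> (real^'n \<Rightarrow> real) set" where
  "W1p_0 p \<Omega> = {u \<in> W1p p \<Omega>. \<forall>\<epsilon>>0. \<exists>\<phi>\<in>test_functions \<Omega>.
     L_p_norm p \<Omega> (\<lambda>x. u x - \<phi> x) + L_p_norm p \<Omega> (\<lambda>x. weak_grad \<Omega> u x - grad \<phi> x) < \<epsilon>}"

text \<open>Weak solutions of \<open>-\<Delta>\<^sub>p u = w |u|\<^sup>p\<^sup>-\<^sup>2 u\<close> in \<open>\<Omega>\<close>, \<open>u = 0\<close> on the boundary. For \<open>p\<close> greater than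
  the dimension and integrable \<open>w\<close> both integrands are automatically integrable: the first by
  Hoelder's inequality, the second because elements of \<open>W\<^sub>0\<^sup>1\<^sup>,\<^sup>p(\<Omega>)\<close> are then essentially bounded.
  Since \<open>0 powr a = 0\<close>, \<open>|\<xi>|\<^sup>p\<^sup>-\<^sup>2 \<xi>\<close> vanishes at \<open>\<xi> = 0\<close> also for \<open>p < 2\<close>.\<close>

definition p_laplace_weak_solution ::
    "real \<Rightarrow> (real^'n::finite) set \<Rightarrow> (real^'n \<Rightarrow> real) \<Rightarrow> (real^'n \<Rightarrow> real) \<Rightarrow> bool" where
  "p_laplace_weak_solution p \<Omega> w u \<longleftrightarrow> u \<in> W1p_0 p \<Omega> \<and>
     (\<forall>\<phi>\<in>W1p_0 p \<Omega>.
        (LINT x|lebesgue_on \<Omega>.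
            (norm (weak_grad \<Omega> u x) powr (p - 2) *\<^sub>R weak_grad \<Omega> u x) \<bullet> weak_grad \<Omega> \<phi> x)
          = (LINT x|lebesgue_on \<Omega>. w x * \<bar>u x\<bar> powr (p - 2) * u x * \<phi> x))"

text \<open>With values in \<^typ>\<open>ennreal\<close>, the distance to an empty boundary is \<open>\<infinity>\<close> (whereas
  \<^const>\<open>infdist\<close> would return 0).\<close>

definition boundary_dist :: "(real^'n::finite) set \<Rightarrow> real^'n \<Rightarrow> ennreal" where
  "boundary_dist \<Omega> x = (INF y\<in>frontier \<Omega>. ennreal (dist x y))"

definition inner_radius :: "(real^'n::finite) set \<Rightarrow> ennreal" where
  "inner_radius \<Omega> = (SUP x\<in>\<Omega>. boundary_dist \<Omega> x)"

end

(* For a C^1 function f, let F(t) be the integral of f(a + t(z - a)) over a cube Q containing a.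
   Hoelder's inequality and the dilation z |-> a + t(z - a) give |F'(t)| <= const * t^(-N/p) ||grad f||_p,
   which is integrable on (0,1) because N < p; hence f(a) is close to the mean of f over Q. Comparing
   two points of Q gives Morrey's inequality without polar coordinates. With one point outside Omega,
   it bounds |u|^p by const * r^(p-N) ||grad u||_p^p on W_0^{1,p}. Testing the equation with u itself gives
   ||grad u||_p^p = int w |u|^p <= ||w||_1 ||u||_oo^p, and ||grad u||_p > 0 cancels. *)
theory Submission
  imports Defs
begin

section \<open>Two one-variable estimates\<close>

text \<open>If s exceeds c, then (s/c)^(p-1) >= 1, so the second term alone dominates s. Integrated
  over a set and with c chosen afterwards, this yields Hoelder's inequality between exponents 1 and
  p up to a factor 2.\<close>

lemma le_add_powr:
  fixes s c p :: real
  assumes "0 \<le> s" "0 < c" "1 \<le> p"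
  shows "s \<le> c + c powr (1 - p) * s powr p"
proof (cases "s \<le> c")
  case True
  then show ?thesis by (simp add: add_increasing2)
next
  case False
  with assms have s: "0 < s" "c \<le> s" by auto
  have "s powr (1 - p) \<le> c powr (1 - p)"
    using assms s by (intro powr_mono2') auto
  then have "s powr (1 - p) * s powr p \<le> c powr (1 - p) * s powr p"
    by (intro mult_right_mono) auto
  moreover have "s powr (1 - p) * s powr p = s"
    using s by (simp flip: powr_add)
  ultimately show ?thesis using assms by linarith
qed

text \<open>The primitive \<open>H\<close> of the majorant is continuous up to 0 because \<alpha> <
  1. On the open interval F - H is nonincreasing and F + H nondecreasing, and continuity carries
  both comparisons to the endpoints.\<close>

lemma singular_derivative_bound:
  fixes F :: "real \<Rightarrow> real"
  assumes der: "\<And>t. 0 < t \<Longrightarrow> t < 1 \<Longrightarrow> (F has_real_derivative F' t) (at t)"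
    and cont: "continuous_on {0..1} F"
    and bound: "\<And>t. 0 < t \<Longrightarrow> t < 1 \<Longrightarrow> \<bar>F' t\<bar> \<le> L * t powr - \<alpha>"
    and "\<alpha> < 1"
  shows "\<bar>F 1 - F 0\<bar> \<le> L / (1 - \<alpha>)"
proof -
  define H where "H t = L / (1 - \<alpha>) * t powr (1 - \<alpha>)" for t :: real
  have H: "(H has_real_derivative L * t powr - \<alpha>) (at t)" if "0 < t" for t
    unfolding H_def
    by (rule DERIV_cong[OF DERIV_cmult[OF has_real_derivative_powr[OF that]]])
      (use \<open>\<alpha> < 1\<close> in simp)
  have Hc: "continuous_on {0..1} H"
    unfolding H_def using \<open>\<alpha> < 1\<close> by (intro continuous_intros continuous_on_powr') auto
  have "F 0 - H 0 \<ge> F 1 - H 1"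
  proof (rule DERIV_nonpos_imp_decreasing_open[of 0 1 "\<lambda>t. F t - H t"])
    show "continuous_on {0..1} (\<lambda>t. F t - H t)"
      by (intro continuous_intros cont Hc)
    fix t :: real assume t: "0 < t" "t < 1"
    show "\<exists>y. ((\<lambda>t. F t - H t) has_real_derivative y) (at t) \<and> y \<le> 0"
      using DERIV_diff[OF der[OF t] H[OF t(1)]] bound[OF t] by fastforce
  qed simp
  moreover have "F 0 + H 0 \<le> F 1 + H 1"
  proof (rule DERIV_nonneg_imp_increasing_open[of 0 1 "\<lambda>t. F t + H t"])
    show "continuous_on {0..1} (\<lambda>t. F t + H t)"
      by (intro continuous_intros cont Hc)
    fix t :: real assume t: "0 < t" "t < 1"
    show "\<exists>y. ((\<lambda>t. F t + H t) has_real_derivative y) (at t) \<and> 0 \<le> y"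
      using DERIV_add[OF der[OF t] H[OF t(1)]] bound[OF t] by fastforce
  qed simp
  ultimately show ?thesis by (simp add: H_def)
qed

section \<open>Cubes and dilations\<close>

lemma norm_diff_cube_le:
  fixes x y l :: "'a::euclidean_space"
  assumes "x \<in> cbox l (l + s *\<^sub>R One)" "y \<in> cbox l (l + s *\<^sub>R One)"
  shows "norm (x - y) \<le> s * DIM('a)"
proof -
  have "norm (x - y) \<le> (\<Sum>b\<in>Basis. \<bar>(x - y) \<bullet> b\<bar>)" by (rule norm_le_l1)
  also have "\<dots> \<le> (\<Sum>b\<in>(Basis::'a set). s)"
  proof (rule sum_mono)
    fix b :: 'a assume b: "b \<in> Basis"
    show "\<bar>(x - y) \<bullet> b\<bar> \<le> s"
      using assms[unfolded mem_box, THEN bspec, OF b] b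
      by (auto simp: inner_simps abs_le_iff)
  qed
  finally show ?thesis by (simp add: mult.commute)
qed

lemma content_cube:
  fixes l :: "'a::euclidean_space"
  assumes "0 \<le> s"
  shows "measure lborel (cbox l (l + s *\<^sub>R One)) = s ^ DIM('a)"
proof -
  have "measure lborel (cbox l (l + s *\<^sub>R One)) = (\<Prod>b\<in>(Basis::'a set). s)"
    using assms by (subst content_cbox) (auto simp: inner_simps intro!: prod.cong)
  then show ?thesis by simp
qed

text \<open>The dilation with centre \<open>a\<close> and ratio \<open>t\<close> maps boxes to boxes
  and has Jacobian t^N. The image box moves with \<open>t\<close>, which is why \<open>G\<close> is
  assumed to bound the integral over every box.\<close>

lemma integral_dilation_le:
  fixes a l u :: "'a::euclidean_space" and h :: "'a \<Rightarrow> real"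
  assumes h: "continuous_on UNIV h" and G: "\<And>c d. integral (cbox c d) h \<le> G" and t: "0 < t"
  shows "integral (cbox l u) (\<lambda>z. h (a + t *\<^sub>R (z - a))) \<le> G / t ^ DIM('a)"
proof -
  define c where "c = (1 - t) *\<^sub>R a"
  define l' u' where "l' = t *\<^sub>R l + c" and "u' = t *\<^sub>R u + c"
  have 1: "(h has_integral integral (cbox l' u') h) (cbox l' u')"
    by (intro integrable_integral integrable_continuous continuous_on_subset[OF h]) auto
  from has_integral_affinity'[OF 1 t, of c] t
  have "((\<lambda>x. h (t *\<^sub>R x + c)) has_integral integral (cbox l' u') h /\<^sub>R t ^ DIM('a)) (cbox l u)"
    by (simp add: l'_def u'_def)
  then have "integral (cbox l u) (\<lambda>x. h (t *\<^sub>R x + c)) = integral (cbox l' u') h / t ^ DIM('a)"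
    by (simp add: integral_unique divide_inverse mult.commute)
  moreover have "t *\<^sub>R x + c = a + t *\<^sub>R (x - a)" for x
    by (simp add: c_def algebra_simps)
  ultimately show ?thesis using G t by (simp add: divide_right_mono)
qed

section \<open>Morrey's inequality\<close>

text \<open>The function \<open>F\<close> below runs from |Q| f(a) at t = 0 to the integral of f at
  t = 1. In the bound, s * N controls |z - a|, the factor 2 comes from \<open>le_add_powr\<close>,
  and the denominator from integrating t^(-N/p) over (0,1).\<close>

lemma morrey_mean_value:
  fixes f :: "'a::euclidean_space \<Rightarrow> real" and g :: "'a \<Rightarrow> 'a" and p s :: real
  assumes der: "\<And>x. (f has_derivative (\<lambda>h. g x \<bullet> h)) (at x)"
    and cont: "continuous_on UNIV g"
    and G: "\<And>c d. integral (cbox c d) (\<lambda>x. norm (g x) powr p) \<le> G"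
    and "0 < G" "real DIM('a) < p" "0 < s"
    and a: "a \<in> cbox l (l + s *\<^sub>R One)"
  defines "Q \<equiv> cbox l (l + s *\<^sub>R One)"
  shows "\<bar>integral Q f - s ^ DIM('a) * f a\<bar>
     \<le> (s * DIM('a) * (2 * s ^ DIM('a) * (G / s ^ DIM('a)) powr (1/p))) / (1 - DIM('a) / p)"
proof -
  let ?N = "DIM('a)"
  let ?V = "s ^ ?N"
  define \<gamma> where "\<gamma> t z = a + t *\<^sub>R (z - a)" for t :: real and z
  define F where "F t = integral Q (\<lambda>z. f (\<gamma> t z))" for t
  define F' where "F' t = integral Q (\<lambda>z. g (\<gamma> t z) \<bullet> (z - a))" for t
  have "1 \<le> ?N" by (simp add: Suc_leI)
  then have p: "1 < p" using \<open>real ?N < p\<close> by linarith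
  have V: "0 < ?V" using \<open>0 < s\<close> by simp
  have contf: "continuous_on UNIV f"
    using der by (meson differentiable_imp_continuous_on differentiable_on_def
        differentiable_def has_derivative_at_withinI)
  have fcont: "continuous_on Q (\<lambda>z. f (\<gamma> t z))" for t
    unfolding \<gamma>_def by (intro continuous_intros continuous_on_compose2[OF contf]) auto
  have gcont: "continuous_on Q (\<lambda>z. g (\<gamma> t z))" for t
    unfolding \<gamma>_def by (intro continuous_intros continuous_on_compose2[OF cont]) auto
  have normcont: "continuous_on UNIV (\<lambda>x. norm (g x) powr p)"
    using p by (intro continuous_on_powr' continuous_intros cont) auto
  \<comment> \<open>\<open>F\<close> is differentiable on the whole line, which also supplies its
    continuity on [0,1]. The bound that follows is singular at t = 0 because it sees g only through
    \<open>G\<close>.\<close>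
  have derF: "(F has_real_derivative F' t) (at t)" for t
    unfolding F_def F'_def Q_def
  proof (rule leibniz_rule_field_derivative[where U=UNIV])
    fix t z
    have "((\<lambda>t. f (\<gamma> t z)) has_derivative (\<lambda>h. g (\<gamma> t z) \<bullet> (h *\<^sub>R (z - a)))) (at t)"
      unfolding \<gamma>_def
      by (rule has_derivative_compose[OF _ der]) (auto intro!: derivative_eq_intros)
    then show "((\<lambda>t. f (\<gamma> t z)) has_field_derivative g (\<gamma> t z) \<bullet> (z - a)) (at t)"
      by (simp add: has_field_derivative_def mult_commute_abs)
  next
    show "continuous_on (UNIV \<times> cbox l (l + s *\<^sub>R One)) (\<lambda>(t, z). g (\<gamma> t z) \<bullet> (z - a))"
      unfolding \<gamma>_def case_prod_beta
      by (intro continuous_intros continuous_on_compose2[OF cont]) auto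
  qed (use fcont in \<open>auto intro!: integrable_continuous simp: Q_def\<close>)
  have bound: "\<bar>F' t\<bar> \<le> (s * ?N * (2 * ?V * (G / ?V) powr (1/p))) * t powr - (?N / p)"
    if t: "0 < t" "t < 1" for t
  proof -
    (* This c balances the two terms of le_add_powr, which stands in for Hoelder. *)
    define c where "c = (G / (?V * t ^ ?N)) powr (1/p)"
    have c: "0 < c" using \<open>0 < s\<close> t \<open>0 < G\<close> by (simp add: c_def)
    have int: "(\<lambda>z. norm (g (\<gamma> t z)) powr p) integrable_on Q"
      unfolding Q_def \<gamma>_def
      by (intro integrable_continuous continuous_on_compose2[OF normcont] continuous_intros) auto
    \<comment> \<open>Cauchy-Schwarz, with |z - a| at most s * N since both points lie in the
      cube.\<close>
    have "\<bar>F' t\<bar> \<le> integral Q (\<lambda>z. (s * ?N) * norm (g (\<gamma> t z)))"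
      unfolding F'_def Q_def real_norm_def[symmetric]
    proof (rule integral_norm_bound_integral)
      fix z assume "z \<in> cbox l (l + s *\<^sub>R One)"
      then have "norm (z - a) \<le> s * ?N" using a by (rule norm_diff_cube_le)
      then show "norm (g (\<gamma> t z) \<bullet> (z - a)) \<le> (s * ?N) * norm (g (\<gamma> t z))"
        using Cauchy_Schwarz_ineq2[of "g (\<gamma> t z)" "z - a"]
        by (smt (verit) mult.commute mult_left_mono norm_ge_zero real_norm_def)
    qed (use gcont in \<open>auto intro!: integrable_continuous continuous_intros simp: Q_def\<close>)
    also have "\<dots> = (s * ?N) * integral Q (\<lambda>z. norm (g (\<gamma> t z)))" by simp
    also have "integral Q (\<lambda>z. norm (g (\<gamma> t z)))
        \<le> integral Q (\<lambda>z. c + c powr (1 - p) * norm (g (\<gamma> t z)) powr p)"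
    proof (rule integral_le)
      show "(\<lambda>z. norm (g (\<gamma> t z))) integrable_on Q"
        using gcont[unfolded Q_def] unfolding Q_def by (intro integrable_continuous continuous_intros)
      show "(\<lambda>z. c + c powr (1 - p) * norm (g (\<gamma> t z)) powr p) integrable_on Q"
        using int unfolding Q_def by (intro integrable_add integrable_on_mult_right) auto
    qed (use c p in \<open>auto intro!: le_add_powr\<close>)
    also have "\<dots> = c * ?V + c powr (1 - p) * integral Q (\<lambda>z. norm (g (\<gamma> t z)) powr p)"
      using int content_cube[of s l] \<open>0 < s\<close> unfolding Q_def
      by (subst integral_add) (auto intro!: integrable_on_mult_right)
    also have "\<dots> \<le> c * ?V + c powr (1 - p) * (G / t ^ ?N)"
      unfolding Q_def \<gamma>_def using a t
      by (intro add_left_mono mult_left_mono integral_dilation_le normcont G) auto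
    also have "G / t ^ ?N = ?V * c powr p"
      using \<open>0 < s\<close> t p \<open>0 < G\<close> by (simp add: c_def powr_powr)
    also have "c * ?V + c powr (1 - p) * (?V * c powr p) = 2 * ?V * c"
      using c by (simp flip: powr_add mult.assoc add: mult.commute[of _ ?V])
    also have "c = (G / ?V) powr (1/p) * t powr - (?N / p)"
    proof -
      have "c = (G / ?V / t ^ ?N) powr (1/p)" by (simp add: c_def)
      also have "\<dots> = (G / ?V) powr (1/p) / (t powr ?N) powr (1/p)"
        using V t \<open>0 < G\<close> by (subst powr_divide) (auto simp: powr_realpow)
      finally show ?thesis using t by (simp add: powr_powr powr_minus divide_inverse)
    qed
    finally show ?thesis using \<open>0 < s\<close> by (simp add: mult_left_mono mult.assoc)
  qed
  have "\<bar>F 1 - F 0\<bar> \<le> (s * ?N * (2 * ?V * (G / ?V) powr (1/p))) / (1 - ?N / p)"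
    by (rule singular_derivative_bound[of F F'])
      (use derF bound p \<open>real ?N < p\<close> in
        \<open>auto intro: continuous_at_imp_continuous_on DERIV_isCont\<close>)
  moreover have "F 1 = integral Q f" by (simp add: F_def \<gamma>_def)
  moreover have "F 0 = ?V * f a"
    using content_cube[of s l] \<open>0 < s\<close> by (simp add: F_def \<gamma>_def Q_def)
  ultimately show ?thesis by simp
qed

text \<open>Both values are compared with the mean of f over one cube containing x and y. Stating
  the result for p-th powers makes it linear in \<open>G\<close>, ready for integrals of |grad
  f|^p.\<close>

lemma morrey:
  fixes f :: "'a::euclidean_space \<Rightarrow> real" and g :: "'a \<Rightarrow> 'a" and p :: real
  assumes der: "\<And>x. (f has_derivative (\<lambda>h. g x \<bullet> h)) (at x)"
    and cont: "continuous_on UNIV g"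
    and G: "\<And>c d. integral (cbox c d) (\<lambda>x. norm (g x) powr p) \<le> G"
    and "0 < G" "real DIM('a) < p" "0 < \<rho>" "dist x y \<le> \<rho>"
  shows "\<bar>f x - f y\<bar> powr p
    \<le> (8 * DIM('a) / (1 - DIM('a) / p)) powr p * \<rho> powr (p - DIM('a)) * G"
proof -
  let ?N = "DIM('a)"
  define s where "s = 2 * \<rho>"
  \<comment> \<open>This corner puts x at the centre of the cube of side 2\<rho>, which therefore
    contains the ball of radius \<rho> about x.\<close>
  define l where "l = x - \<rho> *\<^sub>R One"
  let ?V = "s ^ ?N"
  have s: "0 < s" using \<open>0 < \<rho>\<close> by (simp add: s_def)
  have p: "0 < p" using \<open>real ?N < p\<close> by linarith
  have d: "0 < 1 - ?N / p" using p \<open>real ?N < p\<close> by simp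
  \<comment> \<open>The error in \<open>morrey_mean_value\<close> divided by the volume of the cube.
    With s = 2\<rho> and one error for each of x and y, the factors 2 multiply to the 8 in the
    statement.\<close>
  define E where "E = (s * ?N * (2 * (G / ?V) powr (1/p))) / (1 - ?N / p)"
  have "\<bar>(x - y) \<bullet> b\<bar> \<le> \<rho>" if "b \<in> Basis" for b
    using Basis_le_norm[OF that, of "x - y"] \<open>dist x y \<le> \<rho>\<close> by (simp add: dist_norm)
  then have xy: "x \<in> cbox l (l + s *\<^sub>R One)" "y \<in> cbox l (l + s *\<^sub>R One)"
    using \<open>0 < \<rho>\<close> by (fastforce simp: mem_box l_def s_def inner_simps abs_le_iff)+
  have "\<bar>integral (cbox l (l + s *\<^sub>R One)) f - ?V * f z\<bar> \<le> ?V * E"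
    if "z \<in> cbox l (l + s *\<^sub>R One)" for z
    using morrey_mean_value[OF der cont G \<open>0 < G\<close> \<open>real ?N < p\<close> s that]
    by (simp add: E_def mult_ac)
  from this[OF xy(1)] this[OF xy(2)] have "\<bar>?V * f x - ?V * f y\<bar> \<le> ?V * (2 * E)" by linarith
  then have "\<bar>f x - f y\<bar> \<le> 2 * E"
    using s by (simp add: abs_mult flip: right_diff_distrib)
  then have "\<bar>f x - f y\<bar> powr p \<le> (2 * E) powr p" using p by (intro powr_mono2) auto
  also have "2 * E = (8 * ?N / (1 - ?N / p)) * (\<rho> * (G / ?V) powr (1/p))"
    by (simp add: E_def s_def)
  also have "\<dots> powr p = (8 * ?N / (1 - ?N / p)) powr p * (\<rho> powr p * (G / ?V))"
    using p d s \<open>0 < \<rho>\<close> \<open>0 < G\<close> by (subst powr_mult | simp add: powr_powr)+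
  \<comment> \<open>The gain 2^(-N) from the volume (2\<rho>)^N is given away to simplify the
    constant.\<close>
  also have "\<dots> \<le> (8 * ?N / (1 - ?N / p)) powr p * (\<rho> powr p * (G / \<rho> ^ ?N))"
    using s \<open>0 < \<rho>\<close> \<open>0 < G\<close> unfolding s_def
    by (intro mult_left_mono divide_left_mono power_mono) auto
  also have "\<rho> powr p * (G / \<rho> ^ ?N) = \<rho> powr (p - ?N) * G"
    using \<open>0 < \<rho>\<close> by (simp add: powr_diff powr_realpow)
  finally show ?thesis by (simp add: mult.assoc)
qed

section \<open>p-th powers, L^p functions and approximation\<close>

lemma norm_add_powr_le:
  fixes a b :: "'a::real_normed_vector"
  assumes "0 \<le> p"
  shows "norm (a + b) powr p \<le> 2 powr p * (norm a powr p + norm b powr p)"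
proof -
  define m where "m = max (norm a) (norm b)"
  have "norm (a + b) \<le> 2 * m"
    using norm_triangle_ineq[of a b] by (simp add: m_def)
  then have "norm (a + b) powr p \<le> (2 * m) powr p"
    using assms by (intro powr_mono2) auto
  also have "\<dots> = 2 powr p * m powr p"
    by (simp add: powr_mult m_def)
  also have "m powr p \<le> norm a powr p + norm b powr p"
    by (simp add: m_def max_def)
  finally show ?thesis by simp
qed

lemma L_p_diff:
  assumes "f \<in> L_p p \<Omega>" "g \<in> L_p p \<Omega>" "0 \<le> p"
  shows "(\<lambda>x. f x - g x) \<in> L_p p \<Omega>"
proof -
  have [measurable]: "f \<in> borel_measurable (lebesgue_on \<Omega>)" "g \<in> borel_measurable (lebesgue_on \<Omega>)"
    using assms by (auto simp: L_p_def)
  have "integrable (lebesgue_on \<Omega>) (\<lambda>x. 2 powr p * (norm (f x) powr p + norm (g x) powr p))"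
    using assms by (auto simp: L_p_def)
  then have "integrable (lebesgue_on \<Omega>) (\<lambda>x. norm (f x - g x) powr p)"
    by (rule Bochner_Integration.integrable_bound)
      (use norm_add_powr_le[OF \<open>0 \<le> p\<close>, of "f _" "- g _"] in auto)
  then show ?thesis by (simp add: L_p_def)
qed

lemma L_p_norm_less_imp:
  assumes "L_p_norm p \<Omega> f < \<eta>" "0 < p"
  shows "(LINT x|lebesgue_on \<Omega>. norm (f x) powr p) < \<eta> powr p"
proof -
  let ?I = "LINT x|lebesgue_on \<Omega>. norm (f x) powr p"
  have "?I = (?I powr (1/p)) powr p"
    using \<open>0 < p\<close> by (simp add: powr_powr integral_nonneg_AE)
  also have "\<dots> < \<eta> powr p"
    using assms by (intro powr_less_mono2) (auto simp: L_p_norm_def)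
  finally show ?thesis .
qed

text \<open>The excess of |u| over B is at most |u - \<phi>| whenever |\<phi>| <= B, so its p-th
  power has integral below every \<delta> and vanishes almost everywhere. This passes a uniform
  bound to an L^p limit without extracting a pointwise convergent subsequence.\<close>

lemma AE_bounded_of_approx:
  fixes u :: "'a \<Rightarrow> real"
  assumes "0 < p" and [measurable]: "u \<in> borel_measurable M"
    and approx: "\<And>\<delta>. 0 < \<delta> \<Longrightarrow> \<exists>\<phi>. integrable M (\<lambda>x. \<bar>u x - \<phi> x\<bar> powr p) \<and>
      (\<integral>x. \<bar>u x - \<phi> x\<bar> powr p \<partial>M) < \<delta> \<and> (\<forall>x. \<bar>\<phi> x\<bar> \<le> B)"
  shows "AE x in M. \<bar>u x\<bar> \<le> B"
proof -
  (* e x is the p-th power of the distance from u x to [-B, B], so it is at most |u x - phi x|^p. *)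
  define e where "e x = (max (\<bar>u x\<bar> - B) 0) powr p" for x
  have le: "e x \<le> \<bar>u x - c\<bar> powr p" if "\<bar>c\<bar> \<le> B" for x c
    unfolding e_def using \<open>0 < p\<close> that by (intro powr_mono2) auto
  have [measurable]: "e \<in> borel_measurable M" unfolding e_def by measurable
  have int: "integrable M e"
  proof -
    obtain \<phi> where "integrable M (\<lambda>x. \<bar>u x - \<phi> x\<bar> powr p)" "\<forall>x. \<bar>\<phi> x\<bar> \<le> B"
      using approx[of 1] by auto
    then show ?thesis
      by (intro Bochner_Integration.integrable_bound[of M "\<lambda>x. \<bar>u x - \<phi> x\<bar> powr p" e])
        (use le in \<open>auto simp: e_def\<close>)
  qed
  have "integral\<^sup>L M e \<le> \<delta>" if "0 < \<delta>" for \<delta>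
  proof -
    obtain \<phi> where \<phi>: "integrable M (\<lambda>x. \<bar>u x - \<phi> x\<bar> powr p)" "\<forall>x. \<bar>\<phi> x\<bar> \<le> B"
      "(\<integral>x. \<bar>u x - \<phi> x\<bar> powr p \<partial>M) < \<delta>"
      using approx[OF \<open>0 < \<delta>\<close>] by auto
    have "integral\<^sup>L M e \<le> (\<integral>x. \<bar>u x - \<phi> x\<bar> powr p \<partial>M)"
      using \<phi> le int by (intro integral_mono) auto
    with \<phi> show ?thesis by simp
  qed
  then have "integral\<^sup>L M e \<le> 0" by (rule field_le_epsilon) simp
  moreover have "0 \<le> integral\<^sup>L M e" by (intro integral_nonneg_AE) (simp add: e_def)
  ultimately have "AE x in M. e x = 0"
    using integral_nonneg_eq_0_iff_AE[OF int] by (simp add: e_def)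
  then show ?thesis
    by eventually_elim (use \<open>0 < p\<close> in \<open>auto simp: e_def split: if_splits\<close>)
qed

lemma integrable_continuous_compact_support:
  fixes h :: "'a::euclidean_space \<Rightarrow> 'b::{banach, second_countable_topology}"
  assumes "continuous_on UNIV h" "compact K" "\<And>x. x \<notin> K \<Longrightarrow> h x = 0"
  shows "integrable lebesgue h"
proof -
  have "integrable lborel (\<lambda>x. indicator K x *\<^sub>R h x)"
    by (rule borel_integrable_compact[OF assms(2) continuous_on_subset[OF assms(1) subset_UNIV]])
  also have "(\<lambda>x. indicator K x *\<^sub>R h x) = h"
    using assms(3) by (simp add: fun_eq_iff indicator_def)
  finally show ?thesis
    by (subst integrable_completion) (auto intro: borel_measurable_integrable)
qed

section \<open>Test functions\<close>

context
  fixes \<phi> :: "real^'n::finite \<Rightarrow> real" and \<Omega>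
  assumes \<phi>: "\<phi> \<in> test_functions \<Omega>"
begin

text \<open>A linear map is determined by its values on the standard basis, which here are the
  partial derivatives. This is the form of the derivative that \<open>morrey\<close>
  expects.\<close>

lemma test_function_has_derivative: "(\<phi> has_derivative (\<lambda>h. grad \<phi> x \<bullet> h)) (at x)"
proof -
  have "C_k (Suc 0) \<phi>" using \<phi> unfolding test_functions_def by blast
  then have "\<phi> differentiable (at x)" by (simp add: differentiable_on_def)
  then have der: "(\<phi> has_derivative frechet_derivative \<phi> (at x)) (at x)"
    by (simp add: frechet_derivative_works)
  then interpret linear "frechet_derivative \<phi> (at x)" by (rule has_derivative_linear)
  have "frechet_derivative \<phi> (at x) h = grad \<phi> x \<bullet> h" for h
  proof -
    have "frechet_derivative \<phi> (at x) h = frechet_derivative \<phi> (at x) (\<Sum>i\<in>UNIV. h $ i *\<^sub>R axis i 1)"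
      by (simp add: basis_expansion flip: scalar_mult_eq_scaleR)
    then show ?thesis
      by (simp add: sum scale grad_def partial_deriv_def inner_vec_def mult.commute)
  qed
  then have "frechet_derivative \<phi> (at x) = (\<lambda>h. grad \<phi> x \<bullet> h)" by blast
  with der show ?thesis by simp
qed

lemma test_function_continuous: "continuous_on UNIV \<phi>"
  using \<phi> by (auto simp: test_functions_def dest: spec[of _ "0::nat"])

lemma test_function_continuous_grad: "continuous_on UNIV (grad \<phi>)"
proof -
  have "C_k (Suc 0) \<phi>" using \<phi> unfolding test_functions_def by blast
  then show ?thesis unfolding grad_def by (auto intro!: continuous_on_vec_lambda)
qed

lemma test_function_eq_0: "x \<notin> closure {x. \<phi> x \<noteq> 0} \<Longrightarrow> \<phi> x = 0"
  using closure_subset[of "{x. \<phi> x \<noteq> 0}"] by blast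

lemma test_function_grad_eq_0:
  assumes "x \<notin> closure {x. \<phi> x \<noteq> 0}"
  shows "grad \<phi> x = 0"
proof -
  have "(\<phi> has_derivative (\<lambda>h. 0)) (at x)"
  proof (rule has_derivative_transform_within_open)
    show "((\<lambda>_. 0::real) has_derivative (\<lambda>h. 0)) (at x)" by simp
    show "open (- closure {x. \<phi> x \<noteq> 0})" by (intro open_Compl closed_closure)
    show "x \<in> - closure {x. \<phi> x \<noteq> 0}" using assms by simp
    show "0 = \<phi> y" if "y \<in> - closure {x. \<phi> x \<noteq> 0}" for y
      using that test_function_eq_0[of y] by simp
  qed
  then have "(\<lambda>h. grad \<phi> x \<bullet> h) = (\<lambda>h. 0)"
    using test_function_has_derivative has_derivative_unique by blast
  then show ?thesis by (metis inner_eq_zero_iff)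
qed

lemma test_function_L_p:
  assumes "0 < p" "open \<Omega>"
  shows "\<phi> \<in> L_p p \<Omega>" and "grad \<phi> \<in> L_p p \<Omega>"
proof -
  have K: "compact (closure {x. \<phi> x \<noteq> 0})" using \<phi> by (simp add: test_functions_def)
  have *: "f \<in> L_p p \<Omega>"
    if f: "continuous_on UNIV f" "\<And>x. x \<notin> closure {x. \<phi> x \<noteq> 0} \<Longrightarrow> f x = 0"
    for f :: "real^'n \<Rightarrow> 'c::euclidean_space"
  proof -
    have "integrable lebesgue (\<lambda>x. norm (f x) powr p)"
      using \<open>0 < p\<close> f
      by (intro integrable_continuous_compact_support[OF _ K] continuous_on_powr' continuous_intros) auto
    moreover have "f \<in> borel_measurable (lebesgue_on \<Omega>)"
      using f \<open>open \<Omega>\<close> by (intro continuous_imp_measurable_on_sets_lebesgue)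
        (auto intro: continuous_on_subset)
    ultimately show ?thesis
      using \<open>open \<Omega>\<close>
      by (simp add: L_p_def integrable_restrict_space integrable_mult_indicator
          del: real_scaleR_def)
  qed
  show "\<phi> \<in> L_p p \<Omega>"
    by (rule *[OF test_function_continuous test_function_eq_0])
  show "grad \<phi> \<in> L_p p \<Omega>"
    by (rule *[OF test_function_continuous_grad test_function_grad_eq_0])
qed

text \<open>\<open>morrey\<close> is applied to \<phi> on the whole space, with the second point y
  outside \<Omega>, where \<phi> vanishes. The segment from x to y may leave \<Omega>, which is
  harmless for the extension by zero.\<close>

lemma test_function_bound:
  fixes p :: real
  assumes "open \<Omega>" "real CARD('n) < p" "0 < G" "0 < \<rho>"
    and G: "(LINT x|lebesgue_on \<Omega>. norm (grad \<phi> x) powr p) \<le> G"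
    and near: "\<And>x. x \<in> \<Omega> \<Longrightarrow> \<exists>y. y \<notin> \<Omega> \<and> dist x y \<le> \<rho>"
  shows "\<bar>\<phi> x\<bar> powr p \<le> (8 * CARD('n) / (1 - CARD('n) / p)) powr p * \<rho> powr (p - CARD('n)) * G"
proof (cases "x \<in> \<Omega>")
  case True
  let ?h = "\<lambda>x. norm (grad \<phi> x) powr p"
  have p: "0 < p" using assms(2) by (smt (verit) of_nat_0_le_iff)
  have supp: "closure {x. \<phi> x \<noteq> 0} \<subseteq> \<Omega>" "compact (closure {x. \<phi> x \<noteq> 0})"
    using \<phi> by (simp_all add: test_functions_def)
  have int: "integrable lebesgue ?h"
    using p test_function_continuous_grad test_function_grad_eq_0
    by (intro integrable_continuous_compact_support[OF _ supp(2)] continuous_on_powr' continuous_intros) auto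
  \<comment> \<open>Boxes may stick out of \<Omega>, but the gradient vanishes off the support of
    \<phi>, so its integral over the whole space is the one over \<Omega>.\<close>
  have box: "integral (cbox c d) ?h \<le> G" for c d
  proof -
    have "integral (cbox c d) ?h \<le> integral UNIV ?h"
    proof (rule integral_subset_le)
      show "?h integrable_on cbox c d"
        using p test_function_continuous_grad
        by (intro integrable_continuous continuous_on_powr' continuous_intros)
          (auto intro: continuous_on_subset)
      show "?h integrable_on UNIV"
        using int by (simp add: integrable_on_lebesgue)
    qed auto
    also have "integral UNIV ?h = integral\<^sup>L lebesgue ?h"
      using int by (simp add: integral_lebesgue)
    also have "\<dots> = (LINT x|lebesgue. indicator \<Omega> x *\<^sub>R ?h x)"
      using supp test_function_grad_eq_0
      by (intro Bochner_Integration.integral_cong) (auto simp: indicator_def)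
    also have "\<dots> = (LINT x|lebesgue_on \<Omega>. ?h x)"
      using \<open>open \<Omega>\<close> by (subst integral_restrict_space) auto
    finally show ?thesis using G by simp
  qed
  obtain y where y: "y \<notin> \<Omega>" "dist x y \<le> \<rho>" using near True by blast
  have "\<phi> y = 0" using y supp test_function_eq_0 by blast
  then show ?thesis
    using morrey[OF test_function_has_derivative test_function_continuous_grad box \<open>0 < G\<close> _ \<open>0 < \<rho>\<close> y(2)]
      assms(2) by simp
next
  case False
  moreover have "closure {x. \<phi> x \<noteq> 0} \<subseteq> \<Omega>" using \<phi> by (simp add: test_functions_def)
  ultimately have "\<phi> x = 0" using test_function_eq_0 by blast
  then show ?thesis using \<open>0 < G\<close> by simp
qed

end

section \<open>The essential bound on \<open>W1p_0\<close>\<close>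

text \<open>Test functions close to u have gradient energy at most 2^p (A + \<epsilon>), hence a
  common sup bound, which survives the L^p limit. The \<epsilon> keeps the energy bound positive, as
  \<open>test_function_bound\<close> demands, while A > 0 is still unknown.\<close>

lemma W1p_0_AE_bound:
  fixes \<Omega> :: "(real^'n::finite) set" and p :: real
  assumes u: "u \<in> W1p_0 p \<Omega>"
    and "open \<Omega>" "real CARD('n) < p" "0 < \<epsilon>" "0 < \<rho>"
    and near: "\<And>x. x \<in> \<Omega> \<Longrightarrow> \<exists>y. y \<notin> \<Omega> \<and> dist x y \<le> \<rho>"
  defines "A \<equiv> LINT x|lebesgue_on \<Omega>. norm (weak_grad \<Omega> u x) powr p"
  shows "AE x in lebesgue_on \<Omega>. \<bar>u x\<bar> powr p \<le>
    (8 * CARD('n) / (1 - CARD('n) / p)) powr p * \<rho> powr (p - CARD('n)) * (2 powr p * (A + \<epsilon>))"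
    (is "AE x in _. _ \<le> ?B")
proof -
  have p: "0 < p" using assms(3) by (smt (verit) of_nat_0_le_iff)
  have uL: "u \<in> L_p p \<Omega>" and gL: "weak_grad \<Omega> u \<in> L_p p \<Omega>"
    using u by (auto simp: W1p_0_def W1p_def)
  have A: "0 \<le> A" unfolding A_def by (intro integral_nonneg_AE) auto
  have "AE x in lebesgue_on \<Omega>. \<bar>u x\<bar> \<le> ?B powr (1/p)"
  proof (rule AE_bounded_of_approx[OF p])
    show "u \<in> borel_measurable (lebesgue_on \<Omega>)" using uL by (simp add: L_p_def)
    fix \<delta> :: real assume "0 < \<delta>"
    \<comment> \<open>Makes the p-th power integrals of the two differences smaller than \<delta>
      for the functions and \<epsilon> for the gradients.\<close>
    define \<eta> where "\<eta> = (min \<delta> \<epsilon>) powr (1/p)"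
    have \<eta>: "0 < \<eta>" "\<eta> powr p = min \<delta> \<epsilon>"
      using p \<open>0 < \<delta>\<close> \<open>0 < \<epsilon>\<close> by (auto simp: \<eta>_def powr_powr)
    then obtain \<phi> where \<phi>: "\<phi> \<in> test_functions \<Omega>"
      and *: "L_p_norm p \<Omega> (\<lambda>x. u x - \<phi> x) + L_p_norm p \<Omega> (\<lambda>x. weak_grad \<Omega> u x - grad \<phi> x) < \<eta>"
      using u unfolding W1p_0_def by blast
    have "0 \<le> L_p_norm p \<Omega> f" for f :: "real^'n \<Rightarrow> 'c::euclidean_space"
      by (simp add: L_p_norm_def)
    with * have "L_p_norm p \<Omega> (\<lambda>x. u x - \<phi> x) < \<eta>"
      "L_p_norm p \<Omega> (\<lambda>x. weak_grad \<Omega> u x - grad \<phi> x) < \<eta>"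
      by (smt (verit))+
    from this[THEN L_p_norm_less_imp[OF _ p]]
    have less: "(LINT x|lebesgue_on \<Omega>. norm (u x - \<phi> x) powr p) < \<delta>"
      "(LINT x|lebesgue_on \<Omega>. norm (weak_grad \<Omega> u x - grad \<phi> x) powr p) < \<epsilon>"
      using \<eta> by auto
    note \<phi>L = test_function_L_p[OF \<phi> p \<open>open \<Omega>\<close>]
    have diffL: "(\<lambda>x. u x - \<phi> x) \<in> L_p p \<Omega>" "(\<lambda>x. weak_grad \<Omega> u x - grad \<phi> x) \<in> L_p p \<Omega>"
      using p by (auto intro: L_p_diff uL gL \<phi>L)
    have "(LINT x|lebesgue_on \<Omega>. norm (grad \<phi> x) powr p) \<le> (LINT x|lebesgue_on \<Omega>.
        2 powr p * (norm (weak_grad \<Omega> u x) powr p + norm (weak_grad \<Omega> u x - grad \<phi> x) powr p))"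
    proof (rule integral_mono)
      fix x
      show "norm (grad \<phi> x) powr p
        \<le> 2 powr p * (norm (weak_grad \<Omega> u x) powr p + norm (weak_grad \<Omega> u x - grad \<phi> x) powr p)"
        using norm_add_powr_le[of p "weak_grad \<Omega> u x" "grad \<phi> x - weak_grad \<Omega> u x"] p
        by (simp add: norm_minus_commute)
    qed (use \<phi>L diffL gL in \<open>auto simp: L_p_def\<close>)
    also have "\<dots> \<le> 2 powr p * (A + \<epsilon>)"
      using gL diffL less by (simp add: L_p_def A_def)
    finally have "(LINT x|lebesgue_on \<Omega>. norm (grad \<phi> x) powr p) \<le> 2 powr p * (A + \<epsilon>)" .
    from test_function_bound[OF \<phi> \<open>open \<Omega>\<close> assms(3) _ \<open>0 < \<rho>\<close> this near]
    have "\<bar>\<phi> x\<bar> powr p \<le> ?B" for x using A \<open>0 < \<epsilon>\<close> by simp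
    then have "(\<bar>\<phi> x\<bar> powr p) powr (1/p) \<le> ?B powr (1/p)" for x
      using p by (intro powr_mono2) auto
    then have "\<bar>\<phi> x\<bar> \<le> ?B powr (1/p)" for x using p by (simp add: powr_powr)
    then show "\<exists>\<phi>. integrable (lebesgue_on \<Omega>) (\<lambda>x. \<bar>u x - \<phi> x\<bar> powr p) \<and>
      (LINT x|lebesgue_on \<Omega>. \<bar>u x - \<phi> x\<bar> powr p) < \<delta> \<and> (\<forall>x. \<bar>\<phi> x\<bar> \<le> ?B powr (1/p))"
      using less diffL by (intro exI[of _ \<phi>]) (auto simp: L_p_def)
  qed
  then show ?thesis
  proof eventually_elim
    case (elim x)
    then have "\<bar>u x\<bar> powr p \<le> (?B powr (1/p)) powr p" using p by (intro powr_mono2) auto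
    also have "\<dots> = ?B" using p A \<open>0 < \<epsilon>\<close> by (simp add: powr_powr)
    finally show ?case .
  qed
qed

section \<open>The energy identity and the lower bound for the weight\<close>

text \<open>u is itself an admissible test function. Both integrands then collapse pointwise to p-th
  powers, also at zeros, because \<open>0 powr a = 0\<close>.\<close>

lemma weak_solution_energy:
  assumes "p_laplace_weak_solution p \<Omega> w u"
  shows "(LINT x|lebesgue_on \<Omega>. norm (weak_grad \<Omega> u x) powr p)
    = (LINT x|lebesgue_on \<Omega>. w x * \<bar>u x\<bar> powr p)"
proof -
  have sq: "\<bar>s\<bar> powr (p - 2) * (s * s) = \<bar>s\<bar> powr p" for s :: real
  proof (cases "s = 0")
    case False
    have "\<bar>s\<bar> powr (p - 2) * (s * s) = \<bar>s\<bar> powr (p - 2) * \<bar>s\<bar> powr 2"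
      using False by (simp add: powr_numeral power2_eq_square)
    also have "\<dots> = \<bar>s\<bar> powr p" by (subst powr_add[symmetric]) simp
    finally show ?thesis .
  qed simp
  have v: "(norm v powr (p - 2) *\<^sub>R v) \<bullet> v = norm v powr p" for v :: "real^'a"
    using sq[of "norm v"] by (simp add: power2_eq_square flip: power2_norm_eq_inner)
  have c: "c * \<bar>s\<bar> powr (p - 2) * s * s = c * \<bar>s\<bar> powr p" for c s :: real
    using sq[of s] by (simp add: mult.assoc)
  have "(LINT x|lebesgue_on \<Omega>.
      (norm (weak_grad \<Omega> u x) powr (p - 2) *\<^sub>R weak_grad \<Omega> u x) \<bullet> weak_grad \<Omega> u x)
    = (LINT x|lebesgue_on \<Omega>. w x * \<bar>u x\<bar> powr (p - 2) * u x * u x)"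
    using assms unfolding p_laplace_weak_solution_def by blast
  then show ?thesis by (simp only: v c)
qed

theorem theorem2p1:
  fixes p :: real
  assumes "1 < p" and "real CARD('n::finite) < p"
  shows "\<exists>C>0. \<forall>(\<Omega> :: (real^'n) set) w u.
           open \<Omega> \<and> integrable (lebesgue_on \<Omega>) w \<and> (AE x in lebesgue_on \<Omega>. 0 \<le> w x) \<and>
           p_laplace_weak_solution p \<Omega> w u \<and> \<not> (AE x in lebesgue_on \<Omega>. u x = 0) \<longrightarrow>
           (if inner_radius \<Omega> = \<infinity> then 0
            else C / enn2real (inner_radius \<Omega>) powr (p - real CARD('n)))
             \<le> (LINT x|lebesgue_on \<Omega>. \<bar>w x\<bar>)"
proof -
  let ?N = "real CARD('n)"
  \<comment> \<open>Morrey's constant, the factor from taking \<rho> = 2r, and the 2^p in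
    \<open>W1p_0_AE_bound\<close>. The extra 2 in 1 / (2 * K) comes from choosing \<epsilon> = A
    later.\<close>
  define K where "K = (8 * ?N / (1 - ?N / p)) powr p * 2 powr (p - ?N) * 2 powr p"
  have K: "0 < K" using assms by (simp add: K_def)
  have "1 / (2 * K) / enn2real (inner_radius \<Omega>) powr (p - ?N) \<le> (LINT x|lebesgue_on \<Omega>. \<bar>w x\<bar>)"
    if "open \<Omega>" and w: "integrable (lebesgue_on \<Omega>) w" "AE x in lebesgue_on \<Omega>. 0 \<le> w x"
      and sol: "p_laplace_weak_solution p \<Omega> w u" and nz: "\<not> (AE x in lebesgue_on \<Omega>. u x = 0)"
      and fin: "inner_radius \<Omega> \<noteq> \<infinity>"
    for \<Omega> :: "(real^'n) set" and w u
  \<comment> \<open>For inner radius 0 the left-hand side is 0, since \<open>0 powr a = 0\<close>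
    and division by zero gives 0.\<close>
  proof (cases "inner_radius \<Omega> = 0")
    case False
    define r where "r = enn2real (inner_radius \<Omega>)"
    have r: "inner_radius \<Omega> = ennreal r" "0 < r"
      using False fin by (auto simp: r_def enn2real_positive_iff less_top zero_less_iff_neq_zero)
    define A where "A = (LINT x|lebesgue_on \<Omega>. norm (weak_grad \<Omega> u x) powr p)"
    \<comment> \<open>Doubling r leaves strict room above the infimum, so some frontier point is
      that close; it lies outside \<Omega> because \<Omega> is open.\<close>
    have near: "\<exists>y. y \<notin> \<Omega> \<and> dist x y \<le> 2 * r" if "x \<in> \<Omega>" for x
    proof -
      have "boundary_dist \<Omega> x \<le> ennreal r"
        using that unfolding r(1)[symmetric] inner_radius_def by (rule SUP_upper)
      also have "\<dots> < ennreal (2 * r)" using r by (simp add: ennreal_lessI)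
      finally obtain y where "y \<in> frontier \<Omega>" "ennreal (dist x y) < ennreal (2 * r)"
        unfolding boundary_dist_def INF_less_iff by blast
      then show ?thesis
        using \<open>open \<Omega>\<close> by (intro exI[of _ y]) (auto simp: frontier_def interior_open ennreal_less_iff)
    qed
    have bound: "AE x in lebesgue_on \<Omega>. \<bar>u x\<bar> powr p \<le> K * r powr (p - ?N) * (A + \<epsilon>)"
      if "0 < \<epsilon>" for \<epsilon>
      using W1p_0_AE_bound[OF _ \<open>open \<Omega>\<close> assms(2) that _ near, of u] sol r
      by (simp add: K_def A_def powr_mult mult_ac p_laplace_weak_solution_def)
    have "0 < A"
    proof (rule ccontr)
      assume "\<not> 0 < A"
      then have "A = 0" by (simp add: A_def integral_nonneg_AE order_antisym)
      \<comment> \<open>Countably many values of \<epsilon> share one null set, off which \<epsilon>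
        can tend to 0 pointwise; this forces u = 0 almost everywhere.\<close>
      have "AE x in lebesgue_on \<Omega>. \<forall>n. \<bar>u x\<bar> powr p \<le> K * r powr (p - ?N) * inverse (Suc n)"
        unfolding AE_all_countable using bound[of "inverse (Suc _)"] \<open>A = 0\<close> by simp
      then have "AE x in lebesgue_on \<Omega>. u x = 0"
      proof eventually_elim
        case (elim x)
        have "(\<lambda>n. K * r powr (p - ?N) * inverse (Suc n)) \<longlonglongrightarrow> K * r powr (p - ?N) * 0"
          by (intro tendsto_intros LIMSEQ_inverse_real_of_nat)
        then have "\<bar>u x\<bar> powr p \<le> K * r powr (p - ?N) * 0"
          by (rule LIMSEQ_le_const) (use elim in auto)
        then show ?case by (metis abs_eq_0 mult_zero_right order_antisym powr_eq_0_iff powr_ge_zero)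
      qed
      with nz show False by simp
    qed
    \<comment> \<open>The bound for \<epsilon> = A, legitimate now that A > 0; it is proportional to
      A, so A can be cancelled at the end.\<close>
    define M where "M = K * r powr (p - ?N) * (2 * A)"
    have "0 \<le> M" using K \<open>0 < A\<close> by (simp add: M_def)
    have "A = (LINT x|lebesgue_on \<Omega>. w x * \<bar>u x\<bar> powr p)"
      unfolding A_def using sol by (rule weak_solution_energy)
    also have "\<dots> \<le> (LINT x|lebesgue_on \<Omega>. \<bar>w x\<bar> * M)"
    \<comment> \<open>Integrability is checked for the majorant alone: were the left integrand not
      integrable, its integral would be 0 by convention, and the majorant is nonnegative.\<close>
    proof (rule integral_mono_AE')
      show "AE x in lebesgue_on \<Omega>. w x * \<bar>u x\<bar> powr p \<le> \<bar>w x\<bar> * M"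
        using bound[OF \<open>0 < A\<close>]
        by eventually_elim (auto simp: M_def intro!: mult_mono)
    qed (use w \<open>0 \<le> M\<close> in auto)
    also have "\<dots> = A * (2 * K * r powr (p - ?N) * (LINT x|lebesgue_on \<Omega>. \<bar>w x\<bar>))"
      by (simp add: M_def)
    finally have "1 \<le> 2 * K * r powr (p - ?N) * (LINT x|lebesgue_on \<Omega>. \<bar>w x\<bar>)"
      using \<open>0 < A\<close> by simp
    then show ?thesis
      using K r by (simp add: r_def[symmetric] field_simps)
  qed (simp add: integral_nonneg_AE)
  then show ?thesis
    using K by (intro exI[of _ "1 / (2 * K)"]) (auto simp: integral_nonneg_AE)
qed

end
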